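(* Let $(I,\tilde g,V,\lambda,\mu)$ be an almost $\eta$-Ricci soliton with $\eta=dx^3$ and $V=\sum_{k=1}^3V^kE_k$. Suppose that $f_1=f_1(x^2)$ depends only on $x^2$, $f_2=f_2(x^1)$ depends only on $x^1$, and $V^1,V^2,V^3$ depend only on $x^3$. Then there are $c_1,c_2\in\mathbb R$ and a function $F=F(x^3)$ with $F'=-(\lambda+\mu)$ such that $$V^1=c_1,\quad V^2=c_2,\quad V^3=F,$$ $$c_1f_2\frac{f_1'}{f_1}=-c_2f_1\frac{f_2'}{f_2},\qquad c_2f_2\frac{f_1'}{f_1}=c_1f_1\frac{f_2'}{f_2},$$ $$\lambda=c_1f_1\frac{f_2'}{f_2}+f_1^2\left[\left(\frac{f_2'}{f_2}\right)^2-\left(\frac{f_2'}{f_2}\right)'\right]+f_2^2\left[\left(\frac{f_1'}{f_1}\right)^2-\left(\frac{f_1'}{f_1}\right)'\right].$$ Moreover, if $c_1\neq0$ or $c_2\neq0$, then $f_1$ and $f_2$ are constant, $\lambda=0$, and $F'=-\mu$.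
   Context: Let $I=I_1\times I_2\times I_3\subseteq\mathbb R^3$ with $I_1,I_2,I_3\subseteq\mathbb R$ open intervals and standard coordinates $x^1,x^2,x^3$. Let $f_1,f_2$ be smooth nowhere zero functions on $I$ and endow $I$ with the Riemannian metric $\tilde g=\frac{1}{f_1^2}dx^1\otimes dx^1+\frac{1}{f_2^2}dx^2\otimes dx^2+dx^3\otimes dx^3$. Let $E_1=f_1\frac{\partial}{\partial x^1}$, $E_2=f_2\frac{\partial}{\partial x^2}$, $E_3=\frac{\partial}{\partial x^3}$ (an orthonormal frame). For a smooth vector field $V$, a $1$-form $\eta$, and smooth functions $\lambda,\mu$ on $I$ with $\mu\neq0$ (not identically zero), $(I,\tilde g,V,\lambda,\mu)$ is an almost $\eta$-Ricci soliton if $\frac12\pounds_V\tilde g+\mathrm{Ric}+\lambda\tilde g+\mu\,\eta\otimes\eta=0$ on $I$, where $\pounds_V\tilde g$ is the Lie derivative of $\tilde g$ along $V$ and $\mathrm{Ric}$ is the Ricci tensor of $\tilde g$, with $\mathrm{Ric}(Y,Z)=\sum_{k}\tilde g(R(E_k,Y)Z,E_k)$, $R(X,Y)Z=\nabla_X\nabla_YZ-\nabla_Y\nabla_XZ-\nabla_{[X,Y]}Z$, $\nabla$ the Levi-Civita connection. A prime denotes the derivative of a function of a single variable with respect to that variable. *)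

theory Defs
  imports "HOL-Analysis.Analysis"
begin

text \<open>Differential geometry on an open set \<open>S\<close> of \<open>real^'n\<close> with its standard global chart. Vector fields are
  given by their components with respect to the coordinate frame, covariant tensors by their values on
  tangent vectors. All objects are total functions; only their values on \<open>S\<close> matter.\<close>

type_synonym 'n vfield = "real^'n \<Rightarrow> real^'n"
type_synonym 'n one_form = "real^'n \<Rightarrow> real^'n \<Rightarrow> real"
type_synonym 'n tensor2 = "real^'n \<Rightarrow> real^'n \<Rightarrow> real^'n \<Rightarrow> real"

abbreviation partial :: "'n::finite \<Rightarrow> (real^'n \<Rightarrow> real) \<Rightarrow> real^'n \<Rightarrow> real" where
  "partial i f x \<equiv> frechet_derivative f (at x) (axis i 1)"

fun Ck_on :: "nat \<Rightarrow> (real^'n::finite) set \<Rightarrow> (real^'n \<Rightarrow> real) \<Rightarrow> bool" where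
  "Ck_on 0 S f \<longleftrightarrow> continuous_on S f"
| "Ck_on (Suc k) S f \<longleftrightarrow> (\<forall>x\<in>S. f differentiable (at x)) \<and> (\<forall>i. Ck_on k S (partial i f))"

definition smooth_fun :: "(real^'n::finite) set \<Rightarrow> (real^'n \<Rightarrow> real) \<Rightarrow> bool" where
  "smooth_fun S f \<longleftrightarrow> (\<forall>k. Ck_on k S f)"

definition smooth_vfield :: "(real^'n::finite) set \<Rightarrow> 'n vfield \<Rightarrow> bool" where
  "smooth_vfield S X \<longleftrightarrow> (\<forall>i. smooth_fun S (\<lambda>x. X x $ i))"

definition smooth_one_form :: "(real^'n::finite) set \<Rightarrow> 'n one_form \<Rightarrow> bool" where
  "smooth_one_form S \<eta> \<longleftrightarrow>
     (\<forall>x\<in>S. linear (\<eta> x)) \<and> (\<forall>i. smooth_fun S (\<lambda>x. \<eta> x (axis i 1)))"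

text \<open>Derivative of a function (\<open>X f\<close>), or componentwise of a vector field, in the direction of \<open>X\<close>.\<close>

definition along :: "'n::finite vfield \<Rightarrow> (real^'n \<Rightarrow> 'b::real_normed_vector) \<Rightarrow> real^'n \<Rightarrow> 'b" where
  "along X f x = frechet_derivative f (at x) (X x)"

definition lie_bracket :: "'n::finite vfield \<Rightarrow> 'n vfield \<Rightarrow> 'n vfield" where
  "lie_bracket X Y x = along X Y x - along Y X x"

definition lie_deriv :: "'n::finite vfield \<Rightarrow> 'n tensor2 \<Rightarrow> 'n vfield \<Rightarrow> 'n vfield \<Rightarrow> real^'n \<Rightarrow> real" where
  "lie_deriv V g X Y x =
     along V (\<lambda>y. g y (X y) (Y y)) x - g x (lie_bracket V X x) (Y x) - g x (X x) (lie_bracket V Y x)"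

definition gram :: "'n::finite tensor2 \<Rightarrow> real^'n \<Rightarrow> real^'n^'n" where
  "gram g x = (\<chi> i j. g x (axis i 1) (axis j 1))"

definition christoffel :: "'n::finite tensor2 \<Rightarrow> 'n \<Rightarrow> 'n \<Rightarrow> 'n \<Rightarrow> real^'n \<Rightarrow> real" where
  "christoffel g k i j x = (\<Sum>l\<in>UNIV. matrix_inv (gram g x) $ k $ l *
     (partial i (\<lambda>y. gram g y $ j $ l) x + partial j (\<lambda>y. gram g y $ i $ l) x
       - partial l (\<lambda>y. gram g y $ i $ j) x)) / 2"

text \<open>The Levi-Civita connection in coordinates. The lemmas \<open>levi_civita_torsion_free\<close> and
  \<open>levi_civita_metric\<close> below show that it has the two properties that determine it.\<close>

definition levi_civita :: "'n::finite tensor2 \<Rightarrow> 'n vfield \<Rightarrow> 'n vfield \<Rightarrow> 'n vfield" where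
  "levi_civita g X Y x =
     along X Y x + (\<chi> k. \<Sum>i\<in>UNIV. \<Sum>j\<in>UNIV. christoffel g k i j x * X x $ i * Y x $ j)"

definition riemann :: "'n::finite tensor2 \<Rightarrow> 'n vfield \<Rightarrow> 'n vfield \<Rightarrow> 'n vfield \<Rightarrow> 'n vfield" where
  "riemann g X Y Z x =
     levi_civita g X (levi_civita g Y Z) x - levi_civita g Y (levi_civita g X Z) x
       - levi_civita g (lie_bracket X Y) Z x"

text \<open>\<open>E\<close> is an orthonormal frame for \<open>g\<close>.\<close>

definition ricci ::
  "'n::finite tensor2 \<Rightarrow> ('n \<Rightarrow> 'n vfield) \<Rightarrow> 'n vfield \<Rightarrow> 'n vfield \<Rightarrow> real^'n \<Rightarrow> real" where
  "ricci g E Y Z x = (\<Sum>k\<in>UNIV. g x (riemann g (E k) Y Z x) (E k x))"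

text \<open>Both sides of the soliton equation are tensor fields, so it is stated by evaluation on all
  smooth vector fields.\<close>

definition almost_eta_ricci_soliton ::
  "(real^'n::finite) set \<Rightarrow> 'n tensor2 \<Rightarrow> ('n \<Rightarrow> 'n vfield) \<Rightarrow> 'n one_form \<Rightarrow> 'n vfield
     \<Rightarrow> (real^'n \<Rightarrow> real) \<Rightarrow> (real^'n \<Rightarrow> real) \<Rightarrow> bool" where
  "almost_eta_ricci_soliton S g E \<eta> V lam mu \<longleftrightarrow>
     smooth_vfield S V \<and> smooth_one_form S \<eta> \<and> smooth_fun S lam \<and> smooth_fun S mu \<and>
     (\<exists>x\<in>S. mu x \<noteq> 0) \<and>
     (\<forall>X Y. smooth_vfield S X \<longrightarrow> smooth_vfield S Y \<longrightarrow>
       (\<forall>x\<in>S. lie_deriv V g X Y x / 2 + ricci g E X Y x + lam x * g x (X x) (Y x)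
                + mu x * \<eta> x (X x) * \<eta> x (Y x) = 0))"

text \<open>The metric \<open>(dx1)^2 / f1^2 + (dx2)^2 / f2^2 + (dx3)^2\<close> and its orthonormal frame.\<close>

definition box_metric :: "(real^3 \<Rightarrow> real) \<Rightarrow> (real^3 \<Rightarrow> real) \<Rightarrow> 3 tensor2" where
  "box_metric f1 f2 x u v = u$1 * v$1 / (f1 x)\<^sup>2 + u$2 * v$2 / (f2 x)\<^sup>2 + u$3 * v$3"

definition box_frame :: "(real^3 \<Rightarrow> real) \<Rightarrow> (real^3 \<Rightarrow> real) \<Rightarrow> 3 \<Rightarrow> 3 vfield" where
  "box_frame f1 f2 k x = (if k = 1 then f1 x else if k = 2 then f2 x else 1) *\<^sub>R axis k 1"

definition dx3 :: "3 one_form" where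
  "dx3 x v = v $ 3"

lemma box_frame_orthonormal:
  assumes "f1 x \<noteq> 0" "f2 x \<noteq> 0"
  shows "box_metric f1 f2 x (box_frame f1 f2 i x) (box_frame f1 f2 j x) = (if i = j then 1 else 0)"
  using assms exhaust_3[of i] exhaust_3[of j]
  by (auto simp: box_metric_def box_frame_def axis_def power2_eq_square)

lemma levi_civita_torsion_free:
  fixes g :: "'n::finite tensor2"
  assumes sym: "\<And>y u v. g y u v = g y v u"
  shows "levi_civita g X Y x - levi_civita g Y X x = lie_bracket X Y x"
proof -
  have c: "christoffel g k i j x = christoffel g k j i x" for k i j
    unfolding christoffel_def gram_def by (simp add: sym[of _ "axis i 1" "axis j 1"] add.commute)
  have "(\<Sum>i\<in>UNIV. \<Sum>j\<in>UNIV. christoffel g k i j x * X x $ i * Y x $ j)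
      = (\<Sum>i\<in>UNIV. \<Sum>j\<in>UNIV. christoffel g k i j x * Y x $ i * X x $ j)" for k
    by (subst sum.swap) (simp add: c[of k] mult.commute mult.left_commute)
  then show ?thesis
    by (simp add: levi_civita_def lie_bracket_def)
qed

lemma sum_lin_vec: "linear f \<Longrightarrow> f (v :: real^'n::finite) = (\<Sum>i\<in>UNIV. v $ i * (f (axis i 1) :: real))"
  by (subst basis_expansion[of v, symmetric], unfold scalar_mult_eq_scaleR)
    (simp add: linear_sum linear_cmul)

lemma levi_civita_metric:
  fixes g :: "'n::finite tensor2"
  assumes bil: "\<And>y. bilinear (g y)" and sym: "\<And>y u v. g y u v = g y v u"
    and inv: "invertible (gram g x)"
    and dg: "\<And>i j. (\<lambda>y. gram g y $ i $ j) differentiable (at x)"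
    and dY: "Y differentiable (at x)" and dZ: "Z differentiable (at x)"
  shows "along X (\<lambda>y. g y (Y y) (Z y)) x
    = g x (levi_civita g X Y x) (Z x) + g x (Y x) (levi_civita g X Z x)"
proof -
  define v where "v = X x"
  define G where "G i j = gram g x $ i $ j" for i j
  define D where "D i j l = partial l (\<lambda>y. gram g y $ i $ j) x" for i j l
  have gexp: "g y u w = (\<Sum>i\<in>UNIV. \<Sum>j\<in>UNIV. gram g y $ i $ j * u $ i * w $ j)" for y u w
  proof -
    have l1: "linear (\<lambda>u. g y u w)" and l2: "linear (g y u)" for u w
      using bil[of y] unfolding bilinear_def by auto
    have "g y u w = (\<Sum>i\<in>UNIV. u $ i * g y (axis i 1) w)"
      by (rule sum_lin_vec[OF l1])
    also have "\<dots> = (\<Sum>i\<in>UNIV. u $ i * (\<Sum>j\<in>UNIV. w $ j * g y (axis i 1) (axis j 1)))"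
      by (subst sum_lin_vec[OF l2]) simp
    finally show ?thesis by (simp add: gram_def sum_distrib_left mult_ac)
  qed
  have Gs: "G i j = G j i" for i j unfolding G_def gram_def by (simp add: sym[of x "axis i 1"])
  have Ds: "D i j l = D j i l" for i j l
    unfolding D_def gram_def by (simp add: sym[of _ "axis i 1" "axis j 1"])
  have low: "(\<Sum>k\<in>UNIV. G m k * christoffel g k i j x) = (D j m i + D i m j - D i j m) / 2" for m i j
  proof -
    have mm: "(\<Sum>k\<in>UNIV. G m k * matrix_inv (gram g x) $ k $ l) = (if m = l then 1 else 0)" for l
    proof -
      have "gram g x ** matrix_inv (gram g x) = mat 1"
        using inv someI_ex[of "\<lambda>B. gram g x ** B = mat 1 \<and> B ** gram g x = mat 1"]
        unfolding invertible_def matrix_inv_def by blast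
      then have "(gram g x ** matrix_inv (gram g x)) $ m $ l = mat 1 $ m $ l" by simp
      then show ?thesis by (simp add: matrix_matrix_mult_def mat_def G_def)
    qed
    have "(\<Sum>k\<in>UNIV. G m k * christoffel g k i j x)
       = (\<Sum>k\<in>UNIV. \<Sum>l\<in>UNIV. G m k * matrix_inv (gram g x) $ k $ l * ((D j l i + D i l j - D i j l) / 2))"
      unfolding christoffel_def D_def by (simp add: sum_distrib_left sum_divide_distrib mult_ac)
    also have "\<dots> = (\<Sum>l\<in>UNIV. (\<Sum>k\<in>UNIV. G m k * matrix_inv (gram g x) $ k $ l) * ((D j l i + D i l j - D i j l) / 2))"
      unfolding sum_distrib_right by (rule sum.swap)
    also have "\<dots> = (\<Sum>l\<in>UNIV. (if m = l then (D j l i + D i l j - D i j l) / 2 else 0))"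
      unfolding mm by (intro sum.cong) auto
    finally show ?thesis by simp
  qed
  define dYv where "dYv = along X Y x"
  define dZv where "dZv = along X Z x"
  have hG: "((\<lambda>y. gram g y $ i $ j) has_derivative frechet_derivative (\<lambda>y. gram g y $ i $ j) (at x)) (at x)" for i j
    using dg frechet_derivative_works by blast
  have hY: "(Y has_derivative frechet_derivative Y (at x)) (at x)" and hZ: "(Z has_derivative frechet_derivative Z (at x)) (at x)"
    using dY dZ frechet_derivative_works by blast+
  have hYi: "((\<lambda>y. Y y $ i) has_derivative (\<lambda>h. frechet_derivative Y (at x) h $ i)) (at x)"
    and hZi: "((\<lambda>y. Z y $ i) has_derivative (\<lambda>h. frechet_derivative Z (at x) h $ i)) (at x)" for i
    using bounded_linear.has_derivative[OF bounded_linear_vec_nth hY]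
      bounded_linear.has_derivative[OF bounded_linear_vec_nth hZ] by auto
  have Dv: "frechet_derivative (\<lambda>y. gram g y $ i $ j) (at x) v = (\<Sum>l\<in>UNIV. v $ l * D i j l)" for i j
    unfolding D_def using has_derivative_linear[OF hG] by (rule sum_lin_vec)
  have "((\<lambda>y. \<Sum>i\<in>UNIV. \<Sum>j\<in>UNIV. gram g y $ i $ j * Y y $ i * Z y $ j) has_derivative
     (\<lambda>h. \<Sum>i\<in>UNIV. \<Sum>j\<in>UNIV. (gram g x $ i $ j * Y x $ i) * frechet_derivative Z (at x) h $ j
        + (gram g x $ i $ j * frechet_derivative Y (at x) h $ i
          + frechet_derivative (\<lambda>y. gram g y $ i $ j) (at x) h * Y x $ i) * Z x $ j)) (at x)"
    by (intro has_derivative_sum has_derivative_mult hG hYi hZi)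
  note FD = fun_cong[OF frechet_derivative_at[OF this, symmetric], of v]
  have "along X (\<lambda>y. g y (Y y) (Z y)) x
      = frechet_derivative (\<lambda>y. \<Sum>i\<in>UNIV. \<Sum>j\<in>UNIV. gram g y $ i $ j * Y y $ i * Z y $ j) (at x) v"
    unfolding along_def v_def by (subst gexp) (rule refl)
  then have L: "along X (\<lambda>y. g y (Y y) (Z y)) x = (\<Sum>i\<in>UNIV. \<Sum>j\<in>UNIV. G i j * Y x $ i * dZv $ j
        + (G i j * dYv $ i + (\<Sum>l\<in>UNIV. v $ l * D i j l) * Y x $ i) * Z x $ j)"
    unfolding FD Dv by (simp only: G_def dYv_def dZv_def along_def v_def)
  define C where "C W = (\<chi> k. \<Sum>i\<in>UNIV. \<Sum>j\<in>UNIV. christoffel g k i j x * v $ i * W $ j)" for W :: "real^'n"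
  have Clow: "(\<Sum>k\<in>UNIV. G m k * C W $ k) = (\<Sum>i\<in>UNIV. \<Sum>j\<in>UNIV. (D j m i + D i m j - D i j m) / 2 * v $ i * W $ j)" for m W
  proof -
    have "(\<Sum>k\<in>UNIV. G m k * C W $ k)
       = (\<Sum>k\<in>UNIV. \<Sum>i\<in>UNIV. \<Sum>j\<in>UNIV. G m k * christoffel g k i j x * v $ i * W $ j)"
      unfolding C_def by (simp add: sum_distrib_left mult_ac)
    also have "\<dots> = (\<Sum>i\<in>UNIV. \<Sum>k\<in>UNIV. \<Sum>j\<in>UNIV. G m k * christoffel g k i j x * v $ i * W $ j)"
      by (rule sum.swap)
    also have "\<dots> = (\<Sum>i\<in>UNIV. \<Sum>j\<in>UNIV. \<Sum>k\<in>UNIV. G m k * christoffel g k i j x * v $ i * W $ j)"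
      by (rule sum.cong[OF refl], rule sum.swap)
    also have "\<dots> = (\<Sum>i\<in>UNIV. \<Sum>j\<in>UNIV. (\<Sum>k\<in>UNIV. G m k * christoffel g k i j x) * v $ i * W $ j)"
      by (simp add: sum_distrib_right)
    finally show ?thesis unfolding low .
  qed
  have gG: "g x u w = (\<Sum>i\<in>UNIV. \<Sum>j\<in>UNIV. G i j * u $ i * w $ j)" for u w
    using gexp[of x] unfolding G_def .
  have add: "g x (a + b) w = g x a w + g x b w" "g x w (a + b) = g x w a + g x w b" for a b w
    using bil[of x] by (simp_all add: bilinear_ladd bilinear_radd)
  have A: "g x w (C W) = (\<Sum>m\<in>UNIV. \<Sum>i\<in>UNIV. \<Sum>j\<in>UNIV. (D j m i + D i m j - D i j m) / 2 * v $ i * W $ j * w $ m)" for w W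
  proof -
    have "g x w (C W) = (\<Sum>m\<in>UNIV. w $ m * (\<Sum>k\<in>UNIV. G m k * C W $ k))"
      unfolding gG by (simp add: sum_distrib_left mult_ac)
    then show ?thesis unfolding Clow by (simp add: sum_distrib_left mult_ac)
  qed
  define P where "P = (\<lambda>a b l. v $ l * D a b l * Y x $ a * Z x $ b)"
  have A1: "g x (Y x) (C (Z x)) = (\<Sum>m\<in>UNIV. \<Sum>j\<in>UNIV. \<Sum>i\<in>UNIV. (D j m i + D i m j - D i j m) / 2 * v $ i * Z x $ j * Y x $ m)"
    unfolding A by (rule sum.cong[OF refl], rule sum.swap)
  have A2: "g x (Z x) (C (Y x)) = (\<Sum>m\<in>UNIV. \<Sum>j\<in>UNIV. \<Sum>i\<in>UNIV. (D m j i + D i j m - D i m j) / 2 * v $ i * Y x $ m * Z x $ j)"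
  proof -
    have "g x (Z x) (C (Y x)) = (\<Sum>j\<in>UNIV. \<Sum>m\<in>UNIV. \<Sum>i\<in>UNIV. (D m j i + D i j m - D i m j) / 2 * v $ i * Y x $ m * Z x $ j)"
      unfolding A by (rule sum.cong[OF refl], rule sum.swap)
    then show ?thesis by (subst sum.swap)
  qed
  have "g x (C (Y x)) (Z x) + g x (Y x) (C (Z x)) = (\<Sum>m\<in>UNIV. \<Sum>j\<in>UNIV. \<Sum>i\<in>UNIV. v $ i * D m j i * Y x $ m * Z x $ j)"
    unfolding sym[of x "C (Y x)"] A1 A2 sum.distrib[symmetric]
    by (intro sum.cong refl) (simp add: Ds algebra_simps add_divide_distrib diff_divide_distrib)
  moreover have "g x dYv (Z x) + g x (Y x) dZv + (\<Sum>m\<in>UNIV. \<Sum>j\<in>UNIV. \<Sum>i\<in>UNIV. v $ i * D m j i * Y x $ m * Z x $ j)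
      = along X (\<lambda>y. g y (Y y) (Z y)) x"
    unfolding L gG sum.distrib[symmetric]
    by (intro sum.cong refl) (simp add: algebra_simps sum_distrib_left sum_distrib_right)
  moreover have "levi_civita g X Y x = dYv + C (Y x)" "levi_civita g X Z x = dZv + C (Z x)"
    unfolding levi_civita_def dYv_def dZv_def C_def v_def by simp_all
  ultimately show ?thesis by (simp add: add)
qed

end

theory Submission
  imports Defs
begin

text \<open>Evaluate the soliton equation on pairs of coordinate fields. As \<open>f1\<close> depends on \<open>x2\<close> only and
  \<open>f2\<close> on \<open>x1\<close> only, the Ricci tensor is \<open>K\<close> times the metric of the \<open>(x1, x2)\<close>-surface, where \<open>K\<close> is its
  Gauss curvature. The components 13 and 23 give \<open>(V1)' = (V2)' = 0\<close>, the component 33 gives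
  \<open>(V3)' = - (\<lambda> + \<mu>)\<close>, and the components 11, 22, 12 give the formula for \<open>\<lambda>\<close> and a homogeneous linear
  system for \<open>f2 f1'/f1\<close> and \<open>f1 f2'/f2\<close> with determinant \<open>\<plusminus> (c1\<^sup>2 + c2\<^sup>2)\<close>. If that is nonzero then both
  unknowns vanish, so \<open>f1\<close> and \<open>f2\<close> are constant and the metric is flat.\<close>

section \<open>Derivatives of functions of single coordinates and of their products\<close>

lemma partial_eq:
  assumes "(f has_derivative f') (at x)"
  shows "partial i f x = f' (axis i 1)"
  using frechet_derivative_at[OF assms] by simp

lemma has_derivative_vec_nth [derivative_intros]:
  "((\<lambda>y::real^'n. y $ i) has_derivative (\<lambda>h. h $ i)) (at x within A)"
  by (rule bounded_linear_imp_has_derivative[OF bounded_linear_vec_nth])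

text \<open>The metric coefficients, the Christoffel symbols and the components of \<open>V\<close>
  are all of this product form. The form is required on \<open>S\<close> only, since a derivative at
  \<open>x\<close> sees only an open neighbourhood of \<open>x\<close>.\<close>

lemma has_derivative_separated:
  fixes f :: "real^3 \<Rightarrow> real"
  assumes "open S" "x \<in> S" and eq: "\<And>y. y \<in> S \<Longrightarrow> f y = p (y$1) * q (y$2) * r (y$3)"
    and p: "(p has_real_derivative p') (at (x$1))"
    and q: "(q has_real_derivative q') (at (x$2))"
    and r: "(r has_real_derivative r') (at (x$3))"
  shows "(f has_derivative (\<lambda>h. p' * q (x$2) * r (x$3) * h$1 + p (x$1) * q' * r (x$3) * h$2
            + p (x$1) * q (x$2) * r' * h$3)) (at x)"
proof -
  have c: "((\<lambda>y. u (y$k)) has_derivative (\<lambda>h. u' * h$k)) (at x)"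
    if "(u has_real_derivative u') (at (x$k))" for u u' and k :: 3
    using has_derivative_compose[OF has_derivative_vec_nth[of k x UNIV] that[unfolded has_field_derivative_def]]
    by simp
  have "((\<lambda>y. p (y$1) * q (y$2) * r (y$3)) has_derivative (\<lambda>h. p' * q (x$2) * r (x$3) * h$1
      + p (x$1) * q' * r (x$3) * h$2 + p (x$1) * q (x$2) * r' * h$3)) (at x)"
    by (rule has_derivative_eq_rhs[OF has_derivative_mult[OF has_derivative_mult[OF c[OF p] c[OF q]] c[OF r]]])
       (simp add: fun_eq_iff algebra_simps)
  then show ?thesis
    by (rule has_derivative_transform_within_open[OF _ assms(1,2)]) (simp add: eq)
qed

text \<open>Restrict \<open>f\<close> to the line through \<open>x\<close> in direction
  \<open>axis k 1\<close>, parametrised by the coordinate \<open>k\<close>. Near \<open>x\<close> it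
  coincides there with \<open>p\<close>, so differentiability of \<open>f\<close> passes to
  \<open>p\<close>.\<close>

lemma has_real_derivative_of_coordinate:
  fixes f :: "real^'n::finite \<Rightarrow> real"
  assumes "open S" "x \<in> S" and eq: "\<And>y. y \<in> S \<Longrightarrow> f y = p (y$k)"
    and f: "f differentiable (at x)"
  shows "(p has_real_derivative partial k f x) (at (x$k))"
proof -
  define l where "l t = x + (t - x$k) *\<^sub>R axis k 1" for t
  have lx: "l (x$k) = x" by (simp add: l_def)
  have lk: "l t $ k = t" for t by (simp add: l_def)
  have l: "(l has_derivative (\<lambda>t. t *\<^sub>R axis k 1)) (at (x$k))"
    unfolding l_def by (auto intro!: derivative_eq_intros)
  have fx: "(f has_derivative frechet_derivative f (at x)) (at (l (x$k)))"
    using f by (simp add: lx frechet_derivative_works)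
  have "((\<lambda>t. f (l t)) has_derivative (\<lambda>t. frechet_derivative f (at x) (t *\<^sub>R axis k 1))) (at (x$k))"
    by (rule has_derivative_compose[OF l fx])
  moreover have "frechet_derivative f (at x) (t *\<^sub>R axis k 1) = partial k f x * t" for t
    using linear_cmul[OF has_derivative_linear[OF fx], of t "axis k 1"] by simp
  ultimately have d: "((\<lambda>t. f (l t)) has_real_derivative partial k f x) (at (x$k))"
    by (simp add: has_field_derivative_def)
  \<comment> \<open>The parameters whose point lies in \<open>S\<close> form an open set around
    \<open>x$k\<close>, on which \<open>f (l t) = p t\<close>.\<close>
  have "open (l -` S)"
    unfolding l_def by (intro open_vimage assms(1) continuous_intros)
  from has_derivative_transform_within_open[OF d[unfolded has_field_derivative_def] this]
  show ?thesis
    unfolding has_field_derivative_def by (auto simp: lx assms(2) eq lk)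
qed

lemma Ck_on_const: "Ck_on k S (\<lambda>_. c)"
  by (induction k arbitrary: c) (auto simp: frechet_derivative_const)

text \<open>Makes the coordinate fields admissible test fields in the soliton equation.\<close>

lemma smooth_vfield_const: "smooth_vfield S (\<lambda>_. c)"
  by (simp add: smooth_vfield_def smooth_fun_def Ck_on_const)

lemma smooth_fun_differentiable: "smooth_fun S f \<Longrightarrow> x \<in> S \<Longrightarrow> f differentiable (at x)"
  unfolding smooth_fun_def by (metis Ck_on.simps(2))

lemma smooth_fun_partial: "smooth_fun S f \<Longrightarrow> smooth_fun S (partial i f)"
  unfolding smooth_fun_def by (metis Ck_on.simps(2))

lemma has_derivative_vecI:
  fixes F :: "'a::real_normed_vector \<Rightarrow> real^'n::finite"
  assumes "\<And>i. ((\<lambda>y. F y $ i) has_derivative (\<lambda>h. F' h $ i)) (at x)"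
  shows "(F has_derivative F') (at x)"
  using assms
  by (subst has_derivative_componentwise_within)
     (auto simp: Basis_vec_def inner_axis)

text \<open>\<open>frechet_derivative\<close> is defined by choice. The vector of the component
  derivatives is a derivative of \<open>F\<close>, hence the chosen one by uniqueness.\<close>

lemma frechet_derivative_vec:
  fixes F :: "'a::real_normed_vector \<Rightarrow> real^'n::finite"
  assumes "\<And>i. (\<lambda>y. F y $ i) differentiable (at x)"
  shows "frechet_derivative F (at x) h $ i = frechet_derivative (\<lambda>y. F y $ i) (at x) h"
proof -
  have "(F has_derivative (\<lambda>h. \<chi> i. frechet_derivative (\<lambda>y. F y $ i) (at x) h)) (at x)"
    using assms by (intro has_derivative_vecI) (simp add: frechet_derivative_works)
  from frechet_derivative_at[OF this] show ?thesis by (metis vec_lambda_beta)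
qed

section \<open>Connection and curvature in coordinates\<close>

lemma matrix_inv_diagonal:
  fixes A :: "real^'n^'n"
  assumes "\<And>i j. A $ i $ j = (if i = j then d i else 0)" "\<And>i. d i \<noteq> 0"
  shows "matrix_inv A $ i $ j = (if i = j then 1 / d i else 0)"
proof -
  define B :: "real^'n^'n" where "B = (\<chi> i j. if i = j then 1 / d i else 0)"
  have "A ** B = mat 1" "B ** A = mat 1"
    using assms(2) by (auto simp: vec_eq_iff matrix_matrix_mult_def mat_def assms(1) B_def if_distrib
        [where f="\<lambda>x. x * _"] cong: if_cong)
  \<comment> \<open>\<open>matrix_inv\<close> chooses some inverse, so existence comes first;
    uniqueness of inverses then identifies the choice with \<open>B\<close>.\<close>
  then have "\<exists>C. A ** C = mat 1 \<and> C ** A = mat 1"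
    by blast
  then have "A ** matrix_inv A = mat 1"
    unfolding matrix_inv_def by (rule someI2_ex) simp
  then have "matrix_inv A = B"
    by (metis \<open>B ** A = mat 1\<close> matrix_mul_assoc matrix_mul_lid matrix_mul_rid)
  then show ?thesis by (simp add: B_def)
qed

lemma christoffel_diagonal:
  assumes "\<And>i j. gram g x $ i $ j = (if i = j then d i else 0)" "\<And>i. d i \<noteq> 0"
  shows "christoffel g k i j x = (partial i (\<lambda>y. gram g y $ j $ k) x
    + partial j (\<lambda>y. gram g y $ i $ k) x - partial k (\<lambda>y. gram g y $ i $ j) x) / (2 * d k)"
  unfolding christoffel_def
  by (simp add: matrix_inv_diagonal[OF assms] if_distrib[where f="\<lambda>x. x * _"] cong: if_cong)

lemma along_const [simp]: "along X (\<lambda>_. c) x = 0"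
  by (simp add: along_def frechet_derivative_const)

text \<open>The connection depends on its direction only through the value \<open>X x\<close>, so
  \<open>X\<close> need be a multiple of a coordinate field at the point \<open>x\<close>
  alone.\<close>

lemma levi_civita_at_coordinate_vector:
  assumes "X x = c *\<^sub>R axis k 1"
  shows "levi_civita g X Y x $ l = along X Y x $ l + c * (\<Sum>j\<in>UNIV. christoffel g l k j x * Y x $ j)"
proof -
  have "(\<Sum>i\<in>UNIV. \<Sum>j\<in>UNIV. christoffel g l i j x * X x $ i * Y x $ j)
      = (\<Sum>j\<in>UNIV. \<Sum>i\<in>UNIV. if i = k then c * (christoffel g l k j x * Y x $ j) else 0)"
    unfolding assms by (subst sum.swap) (auto simp: axis_def intro!: sum.cong)
  then show ?thesis by (simp add: levi_civita_def sum_distrib_left)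
qed

lemma sum_mult_axis [simp]:
  fixes c :: "'n::finite \<Rightarrow> real"
  shows "(\<Sum>j\<in>UNIV. c j * axis k 1 $ j) = c k"
  by (simp add: axis_def if_distrib[where f="\<lambda>x. _ * x"] cong: if_cong)

text \<open>The differentiated field is constant, so only the Christoffel term survives. The
  equality is one of fields, so that it can be differentiated again.\<close>

lemma levi_civita_coordinate_field:
  "levi_civita g (\<lambda>y. h y *\<^sub>R axis k 1) (\<lambda>_. axis j 1) = (\<lambda>y. \<chi> l. h y * christoffel g l k j y)"
  by (simp add: fun_eq_iff vec_eq_iff levi_civita_at_coordinate_vector[where X="\<lambda>y. h y *\<^sub>R axis k 1" and k=k, OF refl])

lemma lie_bracket_const_right: "lie_bracket X (\<lambda>_. c) x = - along (\<lambda>_. c) X x"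
  by (simp add: lie_bracket_def)

text \<open>The terms in the derivative of \<open>h\<close> cancel, as the curvature is tensorial in its first argument.\<close>

lemma riemann_coordinate_fields:
  fixes g :: "'n::finite tensor2"
  assumes G: "\<And>l i j. christoffel g l i j differentiable (at x)" and h: "h differentiable (at x)"
  shows "riemann g (\<lambda>y. h y *\<^sub>R axis k 1) (\<lambda>_. axis i 1) (\<lambda>_. axis j 1) x $ l
    = h x * (partial k (christoffel g l i j) x - partial i (christoffel g l k j) x
      + (\<Sum>m\<in>UNIV. christoffel g l k m x * christoffel g m i j x - christoffel g l i m x * christoffel g m k j x))"
proof -
  have Gd: "(christoffel g l i j has_derivative frechet_derivative (christoffel g l i j) (at x)) (at x)" for l i j
    using G frechet_derivative_works by blast
  have hd: "(h has_derivative frechet_derivative h (at x)) (at x)"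
    using h frechet_derivative_works by blast
  have 1: "levi_civita g (\<lambda>_. axis i 1) (\<lambda>_. axis j 1) = (\<lambda>y. \<chi> l. christoffel g l i j y)"
    using levi_civita_coordinate_field[of g "\<lambda>_. 1" i j] by simp
  have 2: "levi_civita g (\<lambda>y. h y *\<^sub>R axis k 1) (\<lambda>_. axis j 1) = (\<lambda>y. \<chi> l. h y * christoffel g l k j y)"
    by (rule levi_civita_coordinate_field)
  have d1: "along (\<lambda>y. h y *\<^sub>R axis k 1) (\<lambda>y. \<chi> l. christoffel g l i j y) x $ l
      = h x * partial k (christoffel g l i j) x"
  proof -
    have "along (\<lambda>y. h y *\<^sub>R axis k 1) (\<lambda>y. \<chi> l. christoffel g l i j y) x $ l
      = frechet_derivative (christoffel g l i j) (at x) (h x *\<^sub>R axis k 1)"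
      unfolding along_def by (subst frechet_derivative_vec) (simp_all add: G)
    then show ?thesis
      using linear_cmul[OF has_derivative_linear[OF Gd]] by simp
  qed
  have d2: "along (\<lambda>_. axis i 1) (\<lambda>y. \<chi> l. h y * christoffel g l k j y) x $ l
      = h x * partial i (christoffel g l k j) x + partial i h x * christoffel g l k j x"
  proof -
    have m: "((\<lambda>y. h y * christoffel g l k j y) has_derivative (\<lambda>v. h x * frechet_derivative (christoffel g l k j) (at x) v
      + frechet_derivative h (at x) v * christoffel g l k j x)) (at x)" for l
      by (rule has_derivative_mult[OF hd Gd])
    then have "along (\<lambda>_. axis i 1) (\<lambda>y. \<chi> l. h y * christoffel g l k j y) x $ l
      = partial i (\<lambda>y. h y * christoffel g l k j y) x"
      unfolding along_def by (subst frechet_derivative_vec) (auto simp: differentiable_def)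
    then show ?thesis using partial_eq[OF m] by simp
  qed
  have "((\<lambda>y. h y *\<^sub>R axis k (1::real)) has_derivative (\<lambda>v. frechet_derivative h (at x) v *\<^sub>R axis k 1)) (at x)"
    by (auto intro!: derivative_eq_intros hd)
  \<comment> \<open>Differentiation along this bracket produces the counterpart of the product-rule
    term \<open>partial i h x * christoffel g l k j x\<close> in \<open>d2\<close>.\<close>
  then have "lie_bracket (\<lambda>y. h y *\<^sub>R axis k 1) (\<lambda>_. axis i 1) x = (- partial i h x) *\<^sub>R axis k 1"
    unfolding lie_bracket_const_right along_def by (simp add: frechet_derivative_at[symmetric])
  then have d3: "levi_civita g (lie_bracket (\<lambda>y. h y *\<^sub>R axis k 1) (\<lambda>_. axis i 1)) (\<lambda>_. axis j 1) x $ l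
      = - partial i h x * christoffel g l k j x"
    by (simp only: levi_civita_at_coordinate_vector along_const sum_mult_axis zero_index add_0)
  have lc: "levi_civita g (\<lambda>y. h y *\<^sub>R axis k 1) Y x $ l
      = along (\<lambda>y. h y *\<^sub>R axis k 1) Y x $ l + h x * (\<Sum>m\<in>UNIV. christoffel g l k m x * Y x $ m)"
    "levi_civita g (\<lambda>_. axis i 1) Y x $ l
      = along (\<lambda>_. axis i 1) Y x $ l + (\<Sum>m\<in>UNIV. christoffel g l i m x * Y x $ m)" for Y
    by (rule levi_civita_at_coordinate_vector, simp)
      (use levi_civita_at_coordinate_vector[of "\<lambda>_. axis i 1" x 1 i] in simp)
  show ?thesis
    unfolding riemann_def 1 2 vector_minus_component d3 lc d1 d2
    by (simp add: sum_subtractf sum_distrib_left algebra_simps)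
qed

section \<open>The metric of the box and its Christoffel symbols\<close>

lemma box_frame_eq:
  "box_frame f1 f2 k = (\<lambda>y. (if k = 1 then f1 y else if k = 2 then f2 y else 1) *\<^sub>R axis k 1)"
  by (simp add: fun_eq_iff box_frame_def)

lemma gram_box_metric:
  "gram (box_metric f1 f2) y $ i $ j
    = (if i = j then if i = 1 then 1 / (f1 y)\<^sup>2 else if i = 2 then 1 / (f2 y)\<^sup>2 else 1 else 0)"
  using exhaust_3[of i] exhaust_3[of j] by (auto simp: gram_def box_metric_def axis_def)

text \<open>\<open>a\<close> and \<open>b\<close> are the one-variable profiles of \<open>f1\<close>
  and \<open>f2\<close>, with the coordinates exchanged: \<open>f1\<close> varies with the second,
  \<open>f2\<close> with the first. Their derivatives are parameters, so that the curvature
  computation becomes algebra in these functions.\<close>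

locale box_chart =
  fixes S :: "(real^3) set" and f1 f2 :: "real^3 \<Rightarrow> real" and a a' a'' b b' b'' :: "real \<Rightarrow> real"
  assumes open_S: "open S"
    and f1: "y \<in> S \<Longrightarrow> f1 y = a (y$2)" and f2: "y \<in> S \<Longrightarrow> f2 y = b (y$1)"
    and a_nz: "y \<in> S \<Longrightarrow> a (y$2) \<noteq> 0" and b_nz: "y \<in> S \<Longrightarrow> b (y$1) \<noteq> 0"
    and a: "y \<in> S \<Longrightarrow> (a has_real_derivative a' (y$2)) (at (y$2))"
    and a': "y \<in> S \<Longrightarrow> (a' has_real_derivative a'' (y$2)) (at (y$2))"
    and b: "y \<in> S \<Longrightarrow> (b has_real_derivative b' (y$1)) (at (y$1))"
    and b': "y \<in> S \<Longrightarrow> (b' has_real_derivative b'' (y$1)) (at (y$1))"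
begin

abbreviation "g \<equiv> box_metric f1 f2"

lemma has_derivative_12:
  assumes x: "x \<in> S" and eq: "\<And>y. y \<in> S \<Longrightarrow> f y = p (y$1) * q (y$2)"
    and p: "(p has_real_derivative p') (at (x$1))"
    and q: "(q has_real_derivative q') (at (x$2))"
  shows "(f has_derivative (\<lambda>h. p' * q (x$2) * h$1 + p (x$1) * q' * h$2)) (at x)"
  using has_derivative_separated[OF open_S x _ p q, of f "\<lambda>_. 1" 0] eq by simp

text \<open>The entry 11 is \<open>1 / a^2\<close> and varies with the second coordinate only, the
  entry 22 is \<open>1 / b^2\<close> and varies with the first only; all other entries are
  constant.\<close>

lemma gram_has_derivative:
  assumes x: "x \<in> S"
  shows "((\<lambda>y. gram g y $ i $ j) has_derivative
    (\<lambda>h. if i = 1 \<and> j = 1 then - 2 * a' (x$2) / a (x$2) ^ 3 * h$2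
      else if i = 2 \<and> j = 2 then - 2 * b' (x$1) / b (x$1) ^ 3 * h$1 else 0)) (at x)"
proof -
  have da: "((\<lambda>t. 1 / (a t)\<^sup>2) has_real_derivative - 2 * a' (x$2) / a (x$2) ^ 3) (at (x$2))"
    using a_nz[OF x] by (auto intro!: derivative_eq_intros a[OF x] simp: field_simps power_eq_if)
  have db: "((\<lambda>t. 1 / (b t)\<^sup>2) has_real_derivative - 2 * b' (x$1) / b (x$1) ^ 3) (at (x$1))"
    using b_nz[OF x] by (auto intro!: derivative_eq_intros b[OF x] simp: field_simps power_eq_if)
  have 1: "((\<lambda>y. gram g y $ 1 $ 1) has_derivative (\<lambda>h. - 2 * a' (x$2) / a (x$2) ^ 3 * h$2)) (at x)"
    by (rule has_derivative_eq_rhs[OF has_derivative_12[OF x _ DERIV_const[of 1] da]])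
       (auto simp: gram_box_metric f1)
  have 2: "((\<lambda>y. gram g y $ 2 $ 2) has_derivative (\<lambda>h. - 2 * b' (x$1) / b (x$1) ^ 3 * h$1)) (at x)"
    by (rule has_derivative_eq_rhs[OF has_derivative_12[OF x _ db DERIV_const[of 1]]])
       (auto simp: gram_box_metric f2)
  have 3: "((\<lambda>y. gram g y $ 3 $ 3) has_derivative (\<lambda>h. 0)) (at x)"
    by (simp add: gram_box_metric)
  have 4: "((\<lambda>y. gram g y $ i $ j) has_derivative (\<lambda>h. 0)) (at x)" if "i \<noteq> j"
    using that by (simp add: gram_box_metric)
  show ?thesis
    using 1 2 3 4 exhaust_3[of i] by (cases "i = j") auto
qed

lemma partial_gram:
  assumes x: "x \<in> S"
  shows "partial l (\<lambda>y. gram g y $ i $ j) x =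
    (if i = 1 \<and> j = 1 \<and> l = 2 then - 2 * a' (x$2) / a (x$2) ^ 3
     else if i = 2 \<and> j = 2 \<and> l = 1 then - 2 * b' (x$1) / b (x$1) ^ 3 else 0)"
  unfolding partial_eq[OF gram_has_derivative[OF x]] by (auto simp: axis_def)

text \<open>\<open>\<Gamma> k i j\<close> is the Christoffel symbol with upper index \<open>k\<close>; \<open>d\<Gamma> l\<close> is its derivative along \<open>xl\<close>.\<close>

definition \<Gamma> :: "3 \<Rightarrow> 3 \<Rightarrow> 3 \<Rightarrow> real^3 \<Rightarrow> real" where
  "\<Gamma> k i j y =
    (if k = 1 \<and> (i = 1 \<and> j = 2 \<or> i = 2 \<and> j = 1) then - a' (y$2) / a (y$2)
     else if k = 2 \<and> (i = 1 \<and> j = 2 \<or> i = 2 \<and> j = 1) then - b' (y$1) / b (y$1)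
     else if k = 2 \<and> i = 1 \<and> j = 1 then (b (y$1))\<^sup>2 * (a' (y$2) / a (y$2) ^ 3)
     else if k = 1 \<and> i = 2 \<and> j = 2 then (b' (y$1) / b (y$1) ^ 3) * (a (y$2))\<^sup>2
     else 0)"

definition d\<Gamma> :: "3 \<Rightarrow> 3 \<Rightarrow> 3 \<Rightarrow> 3 \<Rightarrow> real^3 \<Rightarrow> real" where
  "d\<Gamma> l k i j y =
    (if k = 1 \<and> (i = 1 \<and> j = 2 \<or> i = 2 \<and> j = 1) then
       (if l = 2 then (a' (y$2))\<^sup>2 / (a (y$2))\<^sup>2 - a'' (y$2) / a (y$2) else 0)
     else if k = 2 \<and> (i = 1 \<and> j = 2 \<or> i = 2 \<and> j = 1) then
       (if l = 1 then (b' (y$1))\<^sup>2 / (b (y$1))\<^sup>2 - b'' (y$1) / b (y$1) else 0)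
     else if k = 2 \<and> i = 1 \<and> j = 1 then
       (if l = 1 then 2 * b (y$1) * b' (y$1) * (a' (y$2) / a (y$2) ^ 3)
        else if l = 2 then (b (y$1))\<^sup>2 * (a'' (y$2) / a (y$2) ^ 3 - 3 * (a' (y$2))\<^sup>2 / a (y$2) ^ 4) else 0)
     else if k = 1 \<and> i = 2 \<and> j = 2 then
       (if l = 1 then (b'' (y$1) / b (y$1) ^ 3 - 3 * (b' (y$1))\<^sup>2 / b (y$1) ^ 4) * (a (y$2))\<^sup>2
        else if l = 2 then (b' (y$1) / b (y$1) ^ 3) * (2 * a (y$2) * a' (y$2)) else 0)
     else 0)"

text \<open>The only derivatives of the metric that enter are those of the entry 11 along the second
  axis and of the entry 22 along the first. The 27 index triples are checked one by one.\<close>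

lemma christoffel_eq:
  assumes x: "x \<in> S"
  shows "christoffel g k i j x = \<Gamma> k i j x"
proof -
  have "christoffel g k i j x = (partial i (\<lambda>y. gram g y $ j $ k) x
      + partial j (\<lambda>y. gram g y $ i $ k) x - partial k (\<lambda>y. gram g y $ i $ j) x)
      / (2 * (if k = 1 then 1 / (f1 x)\<^sup>2 else if k = 2 then 1 / (f2 x)\<^sup>2 else 1))"
    by (rule christoffel_diagonal) (use x a_nz b_nz f1 f2 in \<open>auto simp: gram_box_metric\<close>)
  note this[unfolded partial_gram[OF x]]
  moreover have "i = 1 \<or> i = 2 \<or> i = 3" "j = 1 \<or> j = 2 \<or> j = 3" "k = 1 \<or> k = 2 \<or> k = 3"
    by (rule exhaust_3)+
  ultimately show ?thesis
    using a_nz[OF x] b_nz[OF x] unfolding \<Gamma>_def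
    by - (elim disjE, simp_all add: f1[OF x] f2[OF x] field_simps power2_eq_square power3_eq_cube)
qed

text \<open>Each symbol is a function of the first coordinate times a function of the second, so
  only one-variable derivatives of the factors are needed.\<close>

lemma christoffel_has_derivative:
  assumes x: "x \<in> S"
  shows "(christoffel g k i j has_derivative (\<lambda>h. d\<Gamma> 1 k i j x * h$1 + d\<Gamma> 2 k i j x * h$2)) (at x)"
proof -
  note nz = a_nz[OF x] b_nz[OF x]
  note [derivative_intros] = a[OF x] a'[OF x] b[OF x] b'[OF x]
  have q12: "((\<lambda>t. - a' t / a t) has_real_derivative d\<Gamma> 2 1 1 2 x) (at (x$2))"
    using nz by (auto intro!: derivative_eq_intros simp: d\<Gamma>_def field_simps power2_eq_square)
  have p12: "((\<lambda>t. - b' t / b t) has_real_derivative d\<Gamma> 1 2 1 2 x) (at (x$1))"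
    using nz by (auto intro!: derivative_eq_intros simp: d\<Gamma>_def field_simps power2_eq_square)
  have q11: "((\<lambda>t. a' t / a t ^ 3) has_real_derivative a'' (x$2) / a (x$2) ^ 3 - 3 * (a' (x$2))\<^sup>2 / a (x$2) ^ 4) (at (x$2))"
    using nz by (auto intro!: derivative_eq_intros simp: field_simps power_eq_if)
  have p22: "((\<lambda>t. b' t / b t ^ 3) has_real_derivative b'' (x$1) / b (x$1) ^ 3 - 3 * (b' (x$1))\<^sup>2 / b (x$1) ^ 4) (at (x$1))"
    using nz by (auto intro!: derivative_eq_intros simp: field_simps power_eq_if)
  have q22: "((\<lambda>t. (a t)\<^sup>2) has_real_derivative 2 * a (x$2) * a' (x$2)) (at (x$2))"
    by (auto intro!: derivative_eq_intros)
  have p11: "((\<lambda>t. (b t)\<^sup>2) has_real_derivative 2 * b (x$1) * b' (x$1)) (at (x$1))"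
    by (auto intro!: derivative_eq_intros)
  consider "k = 1 \<and> (i = 1 \<and> j = 2 \<or> i = 2 \<and> j = 1)" | "k = 2 \<and> (i = 1 \<and> j = 2 \<or> i = 2 \<and> j = 1)"
    | "k = 2 \<and> i = 1 \<and> j = 1" | "k = 1 \<and> i = 2 \<and> j = 2"
    | "\<not> (k = 1 \<and> (i = 1 \<and> j = 2 \<or> i = 2 \<and> j = 1))" "\<not> (k = 2 \<and> (i = 1 \<and> j = 2 \<or> i = 2 \<and> j = 1))"
      "\<not> (k = 2 \<and> i = 1 \<and> j = 1)" "\<not> (k = 1 \<and> i = 2 \<and> j = 2)"
    by blast
  then show ?thesis
  proof cases
    case 1
    show ?thesis
      by (rule has_derivative_eq_rhs[OF has_derivative_12[OF x _ DERIV_const[of 1] q12]])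
        (use 1 in \<open>auto simp: christoffel_eq \<Gamma>_def d\<Gamma>_def\<close>)
  next
    case 2
    show ?thesis
      by (rule has_derivative_eq_rhs[OF has_derivative_12[OF x _ p12 DERIV_const[of 1]]])
        (use 2 in \<open>auto simp: christoffel_eq \<Gamma>_def d\<Gamma>_def\<close>)
  next
    case 3
    show ?thesis
      by (rule has_derivative_eq_rhs[OF has_derivative_12[OF x _ p11 q11]])
        (use 3 in \<open>auto simp: christoffel_eq \<Gamma>_def d\<Gamma>_def\<close>)
  next
    case 4
    show ?thesis
      by (rule has_derivative_eq_rhs[OF has_derivative_12[OF x _ p22 q22]])
        (use 4 in \<open>auto simp: christoffel_eq \<Gamma>_def d\<Gamma>_def\<close>)
  next
    case 5
    have "\<Gamma> k i j y = 0" "d\<Gamma> l k i j x = 0" for y l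
      unfolding \<Gamma>_def d\<Gamma>_def by (simp_all only: 5 if_False)
    note z = this
    show ?thesis
      by (rule has_derivative_eq_rhs[OF has_derivative_12[OF x _ DERIV_const[of 0] DERIV_const[of 0]]])
        (simp_all add: christoffel_eq z)
  qed
qed

text \<open>No symbol depends on the third coordinate, and \<open>d\<Gamma> 3\<close> is zero by its
  definition.\<close>

lemma partial_christoffel:
  assumes x: "x \<in> S"
  shows "partial l (christoffel g k i j) x = d\<Gamma> l k i j x"
  using exhaust_3[of l] partial_eq[OF christoffel_has_derivative[OF x]]
  by (auto simp: axis_def) (auto simp: d\<Gamma>_def)

text \<open>The Gauss curvature of \<open>dx1\<^sup>2 / f1\<^sup>2 + dx2\<^sup>2 / f2\<^sup>2\<close>.\<close>

definition K :: "real^3 \<Rightarrow> real" where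
  "K x = (f2 x)\<^sup>2 * (a'' (x$2) / a (x$2) - 2 * (a' (x$2) / a (x$2))\<^sup>2)
       + (f1 x)\<^sup>2 * (b'' (x$1) / b (x$1) - 2 * (b' (x$1) / b (x$1))\<^sup>2)"

section \<open>The Ricci tensor\<close>

lemma ricci_coordinate_fields:
  assumes x: "x \<in> S"
  shows "ricci g (box_frame f1 f2) (\<lambda>_. axis i 1) (\<lambda>_. axis j 1) x
    = (if i = j \<and> i \<noteq> 3 then K x * gram g x $ i $ j else 0)"
proof -
  have df: "(\<lambda>y. if k = 1 then f1 y else if k = 2 then f2 y else 1) differentiable (at x)" for k :: 3
  proof -
    have "f1 differentiable (at x)"
      by (rule differentiableI, rule has_derivative_12[OF x _ DERIV_const[of 1] a[OF x]]) (simp add: f1)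
    moreover have "f2 differentiable (at x)"
      by (rule differentiableI, rule has_derivative_12[OF x _ b[OF x] DERIV_const[of 1]]) (simp add: f2)
    ultimately show ?thesis using exhaust_3[of k] by auto
  qed
  have dG: "christoffel g k i j differentiable (at x)" for k i j
    using christoffel_has_derivative[OF x] differentiableI by blast
  \<comment> \<open>Tensoriality pulls out the scale factor of the frame field, and pairing with the
    same frame field divides by it. The trace over the orthonormal frame thus becomes the coordinate
    contraction of the curvature.\<close>
  have "g x (riemann g (box_frame f1 f2 k) (\<lambda>_. axis i 1) (\<lambda>_. axis j 1) x) (box_frame f1 f2 k x)
    = d\<Gamma> k k i j x - d\<Gamma> i k k j x + (\<Sum>m\<in>UNIV. \<Gamma> k k m x * \<Gamma> m i j x - \<Gamma> k i m x * \<Gamma> m k j x)"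
    (is "g x ?R _ = ?r") for k
  proof -
    have "?R $ k = (if k = 1 then f1 x else if k = 2 then f2 x else 1) * ?r"
      unfolding box_frame_eq riemann_coordinate_fields[OF dG df]
      by (simp add: partial_christoffel[OF x] christoffel_eq[OF x])
    moreover have "g x ?R (box_frame f1 f2 k x) = ?R $ k / (if k = 1 then f1 x else if k = 2 then f2 x else 1)"
      using exhaust_3[of k] a_nz[OF x] b_nz[OF x]
      by (auto simp: box_metric_def box_frame_def axis_def f1[OF x] f2[OF x] power2_eq_square)
    ultimately show ?thesis
      using a_nz[OF x] b_nz[OF x] by (simp add: f1[OF x] f2[OF x])
  qed
  then have "ricci g (box_frame f1 f2) (\<lambda>_. axis i 1) (\<lambda>_. axis j 1) x
    = (\<Sum>k\<in>UNIV. d\<Gamma> k k i j x - d\<Gamma> i k k j x + (\<Sum>m\<in>UNIV. \<Gamma> k k m x * \<Gamma> m i j x - \<Gamma> k i m x * \<Gamma> m k j x))"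
    unfolding ricci_def by simp
  also have "\<dots> = (if i = j \<and> i \<noteq> 3 then K x * gram g x $ i $ j else 0)"
  proof -
    \<comment> \<open>For each of the nine index pairs the claim is a rational identity in the
      profiles and their derivatives.\<close>
    have "i = 1 \<or> i = 2 \<or> i = 3" "j = 1 \<or> j = 2 \<or> j = 3"
      by (rule exhaust_3)+
    then show ?thesis
      using a_nz[OF x] b_nz[OF x]
      by - (elim disjE, simp_all add: sum_3 \<Gamma>_def d\<Gamma>_def K_def gram_box_metric f1[OF x] f2[OF x],
        simp_all add: diff_divide_distrib add_divide_distrib power_divide left_diff_distrib
          right_diff_distrib mult_ac power2_eq_square power3_eq_cube power4_eq_xxxx)
  qed
  finally show ?thesis .
qed

section \<open>The Lie derivative of the metric along \<open>V\<close>\<close>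

abbreviation lie_coord :: "3 vfield \<Rightarrow> 3 \<Rightarrow> 3 \<Rightarrow> real^3 \<Rightarrow> real" where
  "lie_coord V i j x \<equiv> lie_deriv V g (\<lambda>_. axis i 1) (\<lambda>_. axis j 1) x"

text \<open>On coordinate fields the bracket \<open>[V, \<partial>i]\<close> is
  \<open>- \<partial>i V\<close>, so the Lie derivative is \<open>V (g_ij) + g (\<partial>i V,
  \<partial>j) + g (\<partial>i, \<partial>j V)\<close>.\<close>

lemma lie_deriv_coordinate_fields:
  assumes x: "x \<in> S"
    and V: "\<forall>y\<in>S. V y = (\<Sum>k\<in>UNIV. v k (y$3) *\<^sub>R box_frame f1 f2 k y)"
    and v: "\<forall>k. (v k has_real_derivative v' k) (at (x$3))"
  shows "lie_coord V 1 1 x = - 2 * v 2 (x$3) * f2 x * a' (x$2) / a (x$2) ^ 3"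
    and "lie_coord V 2 2 x = - 2 * v 1 (x$3) * f1 x * b' (x$1) / b (x$1) ^ 3"
    and "lie_coord V 1 2 x = v 1 (x$3) * a' (x$2) / (a (x$2))\<^sup>2 + v 2 (x$3) * b' (x$1) / (b (x$1))\<^sup>2"
    and "lie_coord V 1 3 x = v' 1 / f1 x" and "lie_coord V 2 3 x = v' 2 / f2 x" and "lie_coord V 3 3 x = 2 * v' 3"
proof -
  \<comment> \<open>The factors 1 bring the components into the shape that
    \<open>has_derivative_separated\<close> expects.\<close>
  have V1: "V y $ 1 = 1 * a (y$2) * v 1 (y$3)" and V2: "V y $ 2 = b (y$1) * 1 * v 2 (y$3)"
    and V3: "V y $ 3 = 1 * 1 * v 3 (y$3)" if "y \<in> S" for y
    by (simp_all add: V[rule_format, OF that] sum_3 box_frame_def axis_def f1[OF that] f2[OF that])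
  have D1: "((\<lambda>y. V y $ 1) has_derivative (\<lambda>h. a' (x$2) * v 1 (x$3) * h$2 + a (x$2) * v' 1 * h$3)) (at x)"
    using has_derivative_separated[OF open_S x V1 DERIV_const a[OF x] v[rule_format]] by simp
  have D2: "((\<lambda>y. V y $ 2) has_derivative (\<lambda>h. b' (x$1) * v 2 (x$3) * h$1 + b (x$1) * v' 2 * h$3)) (at x)"
    using has_derivative_separated[OF open_S x V2 b[OF x] DERIV_const v[rule_format]] by simp
  have D3: "((\<lambda>y. V y $ 3) has_derivative (\<lambda>h. v' 3 * h$3)) (at x)"
    using has_derivative_separated[OF open_S x V3 DERIV_const DERIV_const v[rule_format]] by simp
  have d: "(\<lambda>y. V y $ k) differentiable (at x)" for k
    using exhaust_3[of k] differentiableI[OF D1] differentiableI[OF D2] differentiableI[OF D3] by auto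
  note dV = frechet_derivative_vec[OF d]
  have dV: "frechet_derivative V (at x) h $ 1 = a' (x$2) * v 1 (x$3) * h$2 + a (x$2) * v' 1 * h$3"
    "frechet_derivative V (at x) h $ 2 = b' (x$1) * v 2 (x$3) * h$1 + b (x$1) * v' 2 * h$3"
    "frechet_derivative V (at x) h $ 3 = v' 3 * h$3" for h
    by (simp_all add: dV frechet_derivative_at[OF D1, symmetric] frechet_derivative_at[OF D2, symmetric]
        frechet_derivative_at[OF D3, symmetric])
  have dg: "along V (\<lambda>y. g y (axis i 1) (axis j 1)) x = (\<Sum>l\<in>UNIV. V x $ l * partial l (\<lambda>y. gram g y $ i $ j) x)" for i j
  proof -
    have "linear (frechet_derivative (\<lambda>y. gram g y $ i $ j) (at x))"
      by (rule has_derivative_linear) (use gram_has_derivative[OF x] differentiableI frechet_derivative_works in blast)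
    from sum_lin_vec[OF this, of "V x"] show ?thesis by (simp add: along_def gram_def)
  qed
  have L: "lie_coord V i j x = (\<Sum>l\<in>UNIV. V x $ l * partial l (\<lambda>y. gram g y $ i $ j) x)
     + g x (frechet_derivative V (at x) (axis i 1)) (axis j 1) + g x (axis i 1) (frechet_derivative V (at x) (axis j 1))" for i j
    unfolding lie_deriv_def dg lie_bracket_const_right
    unfolding along_def by (simp add: box_metric_def)
  show "lie_coord V 1 1 x = - 2 * v 2 (x$3) * f2 x * a' (x$2) / a (x$2) ^ 3"
    and "lie_coord V 2 2 x = - 2 * v 1 (x$3) * f1 x * b' (x$1) / b (x$1) ^ 3"
    and "lie_coord V 1 2 x = v 1 (x$3) * a' (x$2) / (a (x$2))\<^sup>2 + v 2 (x$3) * b' (x$1) / (b (x$1))\<^sup>2"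
    and "lie_coord V 1 3 x = v' 1 / f1 x" and "lie_coord V 2 3 x = v' 2 / f2 x" and "lie_coord V 3 3 x = 2 * v' 3"
    using a_nz[OF x] b_nz[OF x]
    unfolding L partial_gram[OF x]
    by (simp_all add: sum_3 box_metric_def dV axis_def V1[OF x] V2[OF x] f1[OF x] f2[OF x] power2_eq_square
        ac_simps)
qed

end


text \<open>On \<open>S\<close> the derivative of \<open>p\<close> is \<open>partial k f\<close>, so
  \<open>deriv p\<close> is to \<open>partial k f\<close> what \<open>p\<close> is to
  \<open>f\<close>. As \<open>partial k f\<close> is again smooth, the argument can be
  repeated.\<close>

lemma smooth_fun_of_coordinate:
  assumes S: "open S" and f: "smooth_fun S f" and eq: "\<And>y. y \<in> S \<Longrightarrow> f y = p (y$k)" and x: "x \<in> S"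
  shows "(p has_real_derivative deriv p (x$k)) (at (x$k))"
    and "(deriv p has_real_derivative deriv (deriv p) (x$k)) (at (x$k))"
proof -
  have 1: "(p has_real_derivative partial k f y) (at (y$k))" if "y \<in> S" for y
    by (rule has_real_derivative_of_coordinate[OF S that eq smooth_fun_differentiable[OF f that]])
  then show "(p has_real_derivative deriv p (x$k)) (at (x$k))"
    using x DERIV_imp_deriv by fastforce
  have "(deriv p has_real_derivative partial k (partial k f) x) (at (x$k))"
    by (rule has_real_derivative_of_coordinate[OF S x _ smooth_fun_differentiable[OF smooth_fun_partial[OF f] x]])
      (use 1 DERIV_imp_deriv in fastforce)
  then show "(deriv p has_real_derivative deriv (deriv p) (x$k)) (at (x$k))"
    using DERIV_imp_deriv by fastforce
qed

section \<open>The soliton equation and its consequences\<close>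

theorem theorem3p19:
  fixes I1 I2 I3 :: "real set" and S :: "(real^3) set"
    and f1 f2 lam mu :: "real^3 \<Rightarrow> real" and V :: "real^3 \<Rightarrow> real^3"
    and Vc :: "3 \<Rightarrow> real^3 \<Rightarrow> real"
    and \<phi>1 \<phi>2 :: "real \<Rightarrow> real" and v :: "3 \<Rightarrow> real \<Rightarrow> real"
  assumes "open I1" "is_interval I1" "open I2" "is_interval I2" "open I3" "is_interval I3"
    and "S = {x. x$1 \<in> I1 \<and> x$2 \<in> I2 \<and> x$3 \<in> I3}"
    and "smooth_fun S f1" "smooth_fun S f2"
    and "\<forall>x\<in>S. f1 x \<noteq> 0" "\<forall>x\<in>S. f2 x \<noteq> 0"
    and "\<forall>x\<in>S. V x = (\<Sum>k\<in>UNIV. Vc k x *\<^sub>R box_frame f1 f2 k x)"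
    and "almost_eta_ricci_soliton S (box_metric f1 f2) (box_frame f1 f2) dx3 V lam mu"
    and "\<forall>x\<in>S. f1 x = \<phi>1 (x$2)"
    and "\<forall>x\<in>S. f2 x = \<phi>2 (x$1)"
    and "\<forall>x\<in>S. \<forall>k. Vc k x = v k (x$3)"
  shows "\<exists>(c1::real) (c2::real) (F::real \<Rightarrow> real).
    (\<forall>x\<in>S. (F has_real_derivative - (lam x + mu x)) (at (x$3))) \<and>
    (\<forall>x\<in>S. Vc 1 x = c1 \<and> Vc 2 x = c2 \<and> Vc 3 x = F (x$3)) \<and>
    (\<forall>x\<in>S.
      c1 * f2 x * (deriv \<phi>1 (x$2) / \<phi>1 (x$2)) = - c2 * f1 x * (deriv \<phi>2 (x$1) / \<phi>2 (x$1)) \<and>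
      c2 * f2 x * (deriv \<phi>1 (x$2) / \<phi>1 (x$2)) = c1 * f1 x * (deriv \<phi>2 (x$1) / \<phi>2 (x$1)) \<and>
      lam x = c1 * f1 x * (deriv \<phi>2 (x$1) / \<phi>2 (x$1))
        + (f1 x)\<^sup>2 * ((deriv \<phi>2 (x$1) / \<phi>2 (x$1))\<^sup>2 - deriv (\<lambda>t. deriv \<phi>2 t / \<phi>2 t) (x$1))
        + (f2 x)\<^sup>2 * ((deriv \<phi>1 (x$2) / \<phi>1 (x$2))\<^sup>2 - deriv (\<lambda>t. deriv \<phi>1 t / \<phi>1 t) (x$2))) \<and>
    (c1 \<noteq> 0 \<or> c2 \<noteq> 0 \<longrightarrow>
      f1 constant_on S \<and> f2 constant_on S \<and> (\<forall>x\<in>S. lam x = 0) \<and>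
      (\<forall>x\<in>S. (F has_real_derivative - mu x) (at (x$3))))"
proof -
  note I = assms(1-6) and S_def = assms(7) and nz = assms(10,11)
  have S: "open S"
  proof -
    have "S = (\<lambda>x. x$1) -` I1 \<inter> (\<lambda>x. x$2) -` I2 \<inter> (\<lambda>x. x$3) -` I3"
      unfolding S_def by auto
    then show ?thesis
      using I by (auto intro!: open_Int open_vimage continuous_intros)
  qed
  note sol = assms(13)[unfolded almost_eta_ricci_soliton_def]
  have f1: "f1 y = \<phi>1 (y$2)" and f2: "f2 y = \<phi>2 (y$1)" if "y \<in> S" for y
    using that assms(14,15) by auto
  interpret box_chart S f1 f2 \<phi>1 "deriv \<phi>1" "deriv (deriv \<phi>1)" \<phi>2 "deriv \<phi>2" "deriv (deriv \<phi>2)"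
  proof
    show "\<phi>1 (y$2) \<noteq> 0" "\<phi>2 (y$1) \<noteq> 0" if "y \<in> S" for y
      using nz that f1 f2 by auto
  qed (use S f1 f2 smooth_fun_of_coordinate[OF S assms(8) f1] smooth_fun_of_coordinate[OF S assms(9) f2] in auto)
  have V: "\<forall>y\<in>S. V y = (\<Sum>k\<in>UNIV. v k (y$3) *\<^sub>R box_frame f1 f2 k y)"
    using assms(12,16) by simp
  \<comment> \<open>Smoothness is given for \<open>V\<close>, not for \<open>v\<close>. Dividing a
    component of \<open>V\<close> by the nowhere zero frame factor \<open>h\<close> recovers a
    differentiable function of the third coordinate.\<close>
  have v: "\<forall>k. (v k has_real_derivative deriv (v k) (x$3)) (at (x$3))" if x: "x \<in> S" for x
  proof
    fix k :: 3
    define h where "h = (if k = 1 then f1 else if k = 2 then f2 else (\<lambda>_. 1))"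
    have "h differentiable (at x)"
      using x assms(8,9) smooth_fun_differentiable by (auto simp: h_def)
    moreover have hnz: "h y \<noteq> 0" if "y \<in> S" for y
      using that nz by (simp add: h_def)
    moreover have "(\<lambda>y. V y $ k) differentiable (at x)"
      using sol x smooth_fun_differentiable unfolding smooth_vfield_def by blast
    ultimately have "(\<lambda>y. V y $ k / h y) differentiable (at x)"
      using x by (intro differentiable_divide) auto
    moreover have "V y $ k / h y = v k (y$3)" if "y \<in> S" for y
    proof -
      have "V y $ k = v k (y$3) * h y"
        using exhaust_3[of k] by (auto simp: V[rule_format, OF that] sum_3 box_frame_def axis_def h_def)
      then show ?thesis using hnz[OF that] by simp
    qed
    ultimately have "(v k has_real_derivative partial 3 (\<lambda>y. V y $ k / h y) x) (at (x$3))"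
      by (intro has_real_derivative_of_coordinate[OF S x])
    then show "(v k has_real_derivative deriv (v k) (x$3)) (at (x$3))"
      using DERIV_imp_deriv by fastforce
  qed
  \<comment> \<open>The test fields are the coordinate fields \<open>i\<close> and \<open>j\<close>;
    the last term is felt only by the pair \<open>i = j = 3\<close>.\<close>
  have eqn: "lie_coord V i j x / 2
      + (if i = j \<and> i \<noteq> 3 then K x * gram g x $ i $ j else 0)
      + lam x * gram g x $ i $ j + mu x * axis i 1 $ 3 * axis j 1 $ 3 = 0" if x: "x \<in> S" for x i j
  proof -
    have "lie_deriv V g X Y x / 2 + ricci g (box_frame f1 f2) X Y x + lam x * g x (X x) (Y x)
        + mu x * dx3 x (X x) * dx3 x (Y x) = 0" if "smooth_vfield S X" "smooth_vfield S Y" for X Y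
      using sol x that by blast
    from this[OF smooth_vfield_const smooth_vfield_const, of "axis i 1" "axis j 1"] show ?thesis
      unfolding ricci_coordinate_fields[OF x] by (simp only: gram_def dx3_def vec_lambda_beta)
  qed
  note lie = lie_deriv_coordinate_fields[OF _ V v]
  \<comment> \<open>\<open>l1\<close> and \<open>l2\<close> are the logarithmic derivatives of the
    profiles. Clearing denominators in the components 11 and 22 yields two expressions for
    \<open>lam\<close> with the same curvature term.\<close>
  define l1 where "l1 x = deriv \<phi>1 (x$2) / \<phi>1 (x$2)" for x :: "real^3"
  define l2 where "l2 x = deriv \<phi>2 (x$1) / \<phi>2 (x$1)" for x :: "real^3"
  have E11: "lam x = v 2 (x$3) * f2 x * l1 x - K x" if x: "x \<in> S" for x
    using eqn[OF x, of 1 1] a_nz[OF x] unfolding lie[OF x x]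
    by (simp add: gram_box_metric axis_def f1[OF x] l1_def field_simps power2_eq_square power3_eq_cube)
  have E22: "lam x = v 1 (x$3) * f1 x * l2 x - K x" if x: "x \<in> S" for x
    using eqn[OF x, of 2 2] b_nz[OF x] unfolding lie[OF x x]
    by (simp add: gram_box_metric axis_def f2[OF x] l2_def field_simps power2_eq_square power3_eq_cube)
  have E12: "v 1 (x$3) * f2 x * l1 x = - v 2 (x$3) * f1 x * l2 x" if x: "x \<in> S" for x
    using eqn[OF x, of 1 2] a_nz[OF x] b_nz[OF x] unfolding lie[OF x x]
    by (simp add: gram_box_metric axis_def f1[OF x] f2[OF x] l1_def l2_def field_simps power2_eq_square)
  have E13: "deriv (v 1) (x$3) = 0" if x: "x \<in> S" for x
    using eqn[OF x, of 1 3] nz x unfolding lie[OF x x]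
    by (simp add: gram_box_metric axis_def)
  have E23: "deriv (v 2) (x$3) = 0" if x: "x \<in> S" for x
    using eqn[OF x, of 2 3] nz x unfolding lie[OF x x]
    by (simp add: gram_box_metric axis_def)
  have E33: "deriv (v 3) (x$3) = - (lam x + mu x)" if x: "x \<in> S" for x
    using eqn[OF x, of 3 3] unfolding lie[OF x x]
    by (simp add: gram_box_metric axis_def)

  \<comment> \<open>Constancy of the first two components of \<open>V\<close>\<close>
  obtain x0 where x0: "x0 \<in> S" using sol by blast
  \<comment> \<open>Derivatives are known only at coordinates of points of \<open>S\<close>;
    \<open>sur\<close> says that every point of \<open>J\<close> is such a coordinate.\<close>
  have const: "\<exists>c. \<forall>t\<in>J. p t = c" if J: "is_interval J"
      and sur: "\<And>t. t \<in> J \<Longrightarrow> \<exists>x\<in>S. x$k = t"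
      and p: "\<And>x. x \<in> S \<Longrightarrow> (p has_real_derivative 0) (at (x$k))"
    for J and p :: "real \<Rightarrow> real" and k :: 3
  proof (rule has_field_derivative_zero_constant)
    show "convex J" using J is_interval_convex by blast
    show "(p has_real_derivative 0) (at t within J)" if "t \<in> J" for t
      using sur[OF that] p has_field_derivative_at_within by blast
  qed
  \<comment> \<open>As \<open>S\<close> is a product, one coordinate of \<open>x0\<close> can be
    moved freely in its interval. The point \<open>x0\<close> exists because \<open>mu\<close> is
    nonzero somewhere.\<close>
  have surj: "\<exists>x\<in>S. x$1 = t" if "t \<in> I1" for t
    using x0 that by (intro bexI[of _ "vector [t, x0$2, x0$3]"]) (auto simp: S_def)
  have surj2: "\<exists>x\<in>S. x$2 = t" if "t \<in> I2" for t
    using x0 that by (intro bexI[of _ "vector [x0$1, t, x0$3]"]) (auto simp: S_def)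
  have surj3: "\<exists>x\<in>S. x$3 = t" if "t \<in> I3" for t
    using x0 that by (intro bexI[of _ "vector [x0$1, x0$2, t]"]) (auto simp: S_def)
  obtain c1 where c1: "\<forall>t\<in>I3. v 1 t = c1"
    using const[OF I(6) surj3, of "v 1"] v[rule_format, of _ 1] E13 by auto
  obtain c2 where c2: "\<forall>t\<in>I3. v 2 t = c2"
    using const[OF I(6) surj3, of "v 2"] v[rule_format, of _ 2] E23 by auto
  have c: "v 1 (x$3) = c1" "v 2 (x$3) = c2" if "x \<in> S" for x
    using that c1 c2 by (auto simp: S_def)
  have d1: "deriv (\<lambda>t. deriv \<phi>1 t / \<phi>1 t) (x$2) = deriv (deriv \<phi>1) (x$2) / \<phi>1 (x$2) - (l1 x)\<^sup>2" if x: "x \<in> S" for x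
    by (rule DERIV_imp_deriv)
      (use a_nz[OF x] in \<open>auto intro!: derivative_eq_intros a[OF x] a'[OF x] simp: l1_def field_simps power2_eq_square\<close>)
  have d2: "deriv (\<lambda>t. deriv \<phi>2 t / \<phi>2 t) (x$1) = deriv (deriv \<phi>2) (x$1) / \<phi>2 (x$1) - (l2 x)\<^sup>2" if x: "x \<in> S" for x
    by (rule DERIV_imp_deriv)
      (use b_nz[OF x] in \<open>auto intro!: derivative_eq_intros b[OF x] b'[OF x] simp: l2_def field_simps power2_eq_square\<close>)
  \<comment> \<open>By \<open>d1\<close> and \<open>d2\<close>,
    \<open>(p'/p)' = p''/p - (p'/p)^2\<close> for each profile, which turns
    \<open>2 (p'/p)^2 - p''/p\<close> into the form of the claim.\<close>
  have K: "- K x = (f1 x)\<^sup>2 * ((l2 x)\<^sup>2 - deriv (\<lambda>t. deriv \<phi>2 t / \<phi>2 t) (x$1))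
      + (f2 x)\<^sup>2 * ((l1 x)\<^sup>2 - deriv (\<lambda>t. deriv \<phi>1 t / \<phi>1 t) (x$2))" if x: "x \<in> S" for x
    unfolding d1[OF x] d2[OF x] K_def l1_def[symmetric] l2_def[symmetric] by (simp add: algebra_simps)
  \<comment> \<open>Hence \<open>v 3\<close> serves as the witness \<open>F\<close>.\<close>
  have F: "(v 3 has_real_derivative - (lam x + mu x)) (at (x$3))" if x: "x \<in> S" for x
    using v[rule_format, OF x, of 3] E33[OF x] by simp
  \<comment> \<open>The second relation equates the two expressions for \<open>lam\<close>, where
    \<open>K\<close> cancels; the first is the component 12.\<close>
  have sys: "c1 * f2 x * l1 x = - c2 * f1 x * l2 x" "c2 * f2 x * l1 x = c1 * f1 x * l2 x"
    and lam: "lam x = c1 * f1 x * l2 x - K x" if x: "x \<in> S" for x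
    using E11[OF x] E22[OF x] E12[OF x] c[OF x] by auto

  \<comment> \<open>Flatness when \<open>c1\<close> or \<open>c2\<close> is nonzero\<close>
  have flat: "f1 constant_on S" "f2 constant_on S" "\<forall>x\<in>S. lam x = 0" if "c1 \<noteq> 0 \<or> c2 \<noteq> 0"
  proof -
    have l: "l1 x = 0 \<and> l2 x = 0" if x: "x \<in> S" for x
    proof -
      \<comment> \<open>With the relations of \<open>sys\<close> called A and B, these are the
        combinations \<open>c1 A + c2 B\<close> and \<open>c1 B - c2 A\<close>.\<close>
      have "(c1\<^sup>2 + c2\<^sup>2) * (f2 x * l1 x) = 0" "(c1\<^sup>2 + c2\<^sup>2) * (f1 x * l2 x) = 0"
        using sys[OF x] by algebra+
      moreover have "c1\<^sup>2 + c2\<^sup>2 \<noteq> 0"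
        using \<open>c1 \<noteq> 0 \<or> c2 \<noteq> 0\<close> by (simp add: sum_power2_eq_zero_iff)
      ultimately show ?thesis using nz x by auto
    qed
    have z: "deriv \<phi>1 (x$2) = 0" "deriv \<phi>2 (x$1) = 0" if x: "x \<in> S" for x
      using l[OF x] a_nz[OF x] b_nz[OF x] by (auto simp: l1_def l2_def)
    obtain k1 where k1: "\<forall>t\<in>I2. \<phi>1 t = k1"
      using const[OF I(4) surj2, of \<phi>1] a z by auto
    obtain k2 where k2: "\<forall>t\<in>I1. \<phi>2 t = k2"
      using const[OF I(2) surj, of \<phi>2] b z by auto
    show "f1 constant_on S" "f2 constant_on S"
      using k1 k2 f1 f2 by (auto simp: constant_on_def S_def)
    \<comment> \<open>The first derivatives vanish on whole open intervals, so the second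
      derivatives vanish too. Then \<open>K\<close> and \<open>l2\<close> are zero, and so is
      \<open>lam\<close>.\<close>
    have "deriv (deriv \<phi>1) (x$2) = 0" "deriv (deriv \<phi>2) (x$1) = 0" if x: "x \<in> S" for x
    proof -
      have "0 = deriv \<phi>1 t" if "t \<in> I2" for t
        using surj2[OF that] z by auto
      then have "(deriv \<phi>1 has_real_derivative 0) (at (x$2))"
        using x by (intro has_field_derivative_transform_within_open[OF DERIV_const[of 0] I(3)]) (auto simp: S_def)
      moreover have "0 = deriv \<phi>2 t" if "t \<in> I1" for t
        using surj[OF that] z by auto
      then have "(deriv \<phi>2 has_real_derivative 0) (at (x$1))"
        using x by (intro has_field_derivative_transform_within_open[OF DERIV_const[of 0] I(1)]) (auto simp: S_def)
      ultimately show "deriv (deriv \<phi>1) (x$2) = 0" "deriv (deriv \<phi>2) (x$1) = 0"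
        by (simp_all add: DERIV_imp_deriv)
    qed
    then show "\<forall>x\<in>S. lam x = 0"
      using lam l z by (simp add: K_def)
  qed
  show ?thesis
  proof (intro exI conjI ballI impI)
    fix x assume x: "x \<in> S"
    show "(v 3 has_real_derivative - (lam x + mu x)) (at (x$3))" by (rule F[OF x])
    show "Vc 1 x = c1" "Vc 2 x = c2" "Vc 3 x = v 3 (x$3)"
      using c[OF x] assms(16) x by auto
    show "c1 * f2 x * (deriv \<phi>1 (x$2) / \<phi>1 (x$2)) = - c2 * f1 x * (deriv \<phi>2 (x$1) / \<phi>2 (x$1))"
      "c2 * f2 x * (deriv \<phi>1 (x$2) / \<phi>1 (x$2)) = c1 * f1 x * (deriv \<phi>2 (x$1) / \<phi>2 (x$1))"
      using sys[OF x] by (simp_all add: l1_def l2_def)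
    show "lam x = c1 * f1 x * (deriv \<phi>2 (x$1) / \<phi>2 (x$1))
        + (f1 x)\<^sup>2 * ((deriv \<phi>2 (x$1) / \<phi>2 (x$1))\<^sup>2 - deriv (\<lambda>t. deriv \<phi>2 t / \<phi>2 t) (x$1))
        + (f2 x)\<^sup>2 * ((deriv \<phi>1 (x$2) / \<phi>1 (x$2))\<^sup>2 - deriv (\<lambda>t. deriv \<phi>1 t / \<phi>1 t) (x$2))"
      using lam[OF x] K[OF x] unfolding l1_def l2_def by linarith
    assume "c1 \<noteq> 0 \<or> c2 \<noteq> 0"
    then show "lam x = 0" "(v 3 has_real_derivative - mu x) (at (x$3))"
      using flat(3) F[OF x] x by auto
  qed (use flat in auto)
qed

end
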